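(* Let $b:\mathbb{N}\to\mathbb{N}$ be a function with the following property: for every commutative Euclidean domain $\mathcal{R}$, every finite alphabet $X$, every length-compatible monomial well-ordering on the words in $X$, every $d\in\mathbb{N}$ and every finite set $\mathcal{G}\subset\mathcal{R}\langle X\rangle\setminus\{0\}$ whose elements involve only monomials of length at most $d$, if no new polynomials are added to $\mathcal{G}$ when Buchberger's algorithm is run on $\mathcal{G}$ up to length $b(d)$, then $\mathcal{G}$ is a strong Gröbner basis for the two-sided ideal $\langle\mathcal{G}\rangle$. Then $b(d)\ge 3d-1$ for all $d\in\mathbb{N}$.
   Context: **Setting.** $\mathcal{P}=\mathcal{R}\langle X\rangle$ is the free associative $\mathcal{R}$-algebra; $\mathcal{B}=\langle X\rangle$ is the free monoid of words (monomials). $\mathcal{P}^e=\mathcal{P}\otimes_{\mathcal{R}}\mathcal{P}^{\mathrm{opp}}$ has basis $\mathcal{B}^e=\{u\otimes v:u,v\in\mathcal{B}\}$ and acts by $(u\otimes v)\cdot t=utv$. $|\cdot|$ denotes the Euclidean norm on $\mathcal{R}$ and also the length of a word. A monomial ordering is length-compatible if $u\preceq v$ implies $|u|\le|v|$. $\mathrm{lm},\mathrm{lc},\mathrm{lt}$ are leading monomial, coefficient, term. A word $u$ divides a word $v$ if $v=\tau\cdot u$ for some $\tau\in\mathcal{B}^e$; a term $c\,u$ divides $c'v$ if $c\mid c'$ and $u$ divides $v$. **Strong Gröbner basis.** $\mathrm{L}(\mathcal{S})=\langle \mathrm{lt}(f): f\in\mathcal{S}\setminus\{0\}\rangle$. $\mathcal{G}$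 is a strong Gröbner basis for $\mathcal{I}=\langle\mathcal{G}\rangle$ if $\mathrm{L}(\mathcal{I})\subseteq\mathrm{L}(\mathcal{G})$ and for every $f'\in\mathcal{I}\setminus\{0\}$ some $g'\in\mathcal{G}$ has $\mathrm{lt}(g')$ dividing $\mathrm{lt}(f')$. **Reduction.** $g$ lm-reduces $f$ if $\mathrm{lm}(f)=\tau\,\mathrm{lm}(g)$ for some $\tau\in\mathcal{B}^e$ and there are $a,b'\in\mathcal{R}$ with $a\neq0$, $|b'|<|\mathrm{lc}(f)|$, $\mathrm{lc}(f)=a\,\mathrm{lc}(g)+b'$; the lm-reduction is $f-a\tau g$. A polynomial reduces to zero with respect to $\mathcal{G}$ if it is zero or some finite chain of lm-reductions by elements of $\mathcal{G}$ leads from it to $0$. **Overlaps.** $\mathrm{LCM}(u,v)$ is the set of words $t$ such that for some $t_1,t_2\in\mathcal{B}$: (1) $t=ut_1=t_2v$ with $|t_1|<|v|,|t_2|<|u|$; or (2) $t=t_1u=vt_2$ with $|t_1|<|v|,|t_2|<|u|$; or (3) $t=t_1ut_2=v$; or (4) $t=u=t_1vt_2$. **S- and G-polynomials.** For $f,g\in\mathcal{P}\setminus\{0\}$ let $\mathrm{lcm}(\mathrm{lc}(f),\mathrm{lc}(g))=a_f\mathrm{lc}(f)=a_g\mathrm{lc}(g)$ and $\gcd(\mathrm{lc}(f),\mathrm{lc}(g))=b_f\mathrm{lc}(f)+b_g\mathrm{lc}(g)$ (Bézout coefficients from a fixed implementation of the Euclidean algorithm). First type, for $t\in\mathrm{LCM}(\mathrm{lm}(f),\mathrm{lm}(g))$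 and any $\tau_f,\tau_g\in\mathcal{B}^e$ with $\tau_f\mathrm{lm}(f)=\tau_g\mathrm{lm}(g)=t$: $\mathrm{spoly}_1^t(f,g)=a_f\tau_ff-a_g\tau_gg$, $\mathrm{gpoly}_1^t(f,g)=b_f\tau_ff+b_g\tau_gg$. Second type, for $w\in\mathcal{B}$: $\mathrm{spoly}_2^w(f,g)=a_ffw\,\mathrm{lm}(g)-a_g\mathrm{lm}(f)wg$, $\mathrm{gpoly}_2^w(f,g)=b_ffw\,\mathrm{lm}(g)+b_g\mathrm{lm}(f)wg$. **Buchberger's algorithm up to length $\ell$.** Starting with $\mathcal{G}$, the algorithm forms, for all ordered pairs $f,g$ in the current set (including $f=g$), all first type S- and G-polynomials with $|t|\le\ell$ and all second type S- and G-polynomials with $|\mathrm{lm}(f)|+|w|+|\mathrm{lm}(g)|\le\ell$, reduces each by lm-reductions with respect to the current set to a normal form (a polynomial that cannot be lm-reduced further), and adds every nonzero normal form to the set. Thus "no new polynomials are added to $\mathcal{G}$ up to length $\ell$" means that all these S- and G-polynomials of pairs from $\mathcal{G}$ reduce to zero with respect to $\mathcal{G}$. *)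

theory Defs
  imports "HOL-Algebra.Ring_Divisibility" "HOL-Library.Sublist"
begin

section \<open>Euclidean norms\<close>

text \<open>
  \<^locale>\<open>euclidean_domain\<close> does not ask the norm to be monotone along divisibility, unlike
  \<^class>\<open>euclidean_semiring\<close>.  Without it lm-reduction is meaningless: on the integers, \<open>\<phi> n = \<bar>n\<bar>\<close>
  except \<open>\<phi> 1 = 100\<close> satisfies \<^locale>\<open>euclidean_domain\<close>, and \<open>1 = 2 * 2 + (-3)\<close> would be a
  norm-decreasing division of \<open>1\<close>.
\<close>

definition euclidean_norm :: "('a, 'm) ring_scheme \<Rightarrow> ('a \<Rightarrow> nat) \<Rightarrow> bool" where
  "euclidean_norm R \<phi> \<longleftrightarrow> euclidean_domain R \<phi> \<and>
    (\<forall>a\<in>carrier R - {\<zero>\<^bsub>R\<^esub>}. \<forall>b\<in>carrier R - {\<zero>\<^bsub>R\<^esub>}. \<phi> a \<le> \<phi> (a \<otimes>\<^bsub>R\<^esub> b))"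


section \<open>The free associative algebra over a ring on an alphabet\<close>

text \<open>
  Words are lists and the free monoid on \<open>X\<close> is \<open>lists X\<close>.  A noncommutative polynomial is its
  coefficient function, with finite support contained in \<open>lists X\<close>.  A word \<open>w\<close> factors into two
  words exactly as \<open>take i w @ drop i w\<close> with \<open>i \<le> length w\<close>, so the product below is the usual
  convolution.
\<close>

definition supp :: "('a, 'm) ring_scheme \<Rightarrow> ('x list \<Rightarrow> 'a) \<Rightarrow> 'x list set" where
  "supp R f = {u. f u \<noteq> \<zero>\<^bsub>R\<^esub>}"

definition nc_monom :: "('a, 'm) ring_scheme \<Rightarrow> 'a \<Rightarrow> 'x list \<Rightarrow> 'x list \<Rightarrow> 'a" where
  "nc_monom R c u = (\<lambda>w. if w = u then c else \<zero>\<^bsub>R\<^esub>)"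

definition free_algebra :: "('a, 'm) ring_scheme \<Rightarrow> 'x set \<Rightarrow> ('x list \<Rightarrow> 'a) ring" where
  "free_algebra R X =
    \<lparr>carrier = {f. range f \<subseteq> carrier R \<and> finite (supp R f) \<and> supp R f \<subseteq> lists X},
     mult = (\<lambda>f g w. \<Oplus>\<^bsub>R\<^esub>i\<in>{..length w}. f (take i w) \<otimes>\<^bsub>R\<^esub> g (drop i w)),
     one = nc_monom R \<one>\<^bsub>R\<^esub> [],
     zero = (\<lambda>w. \<zero>\<^bsub>R\<^esub>),
     add = (\<lambda>f g w. f w \<oplus>\<^bsub>R\<^esub> g w)\<rparr>"

text \<open>\<open>bimul R X c u v f\<close> is \<open>c u f v\<close>, i.e. \<open>c\<close> times the action of \<open>u \<otimes> v\<close> on \<open>f\<close>.\<close>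

definition bimul :: "('a, 'm) ring_scheme \<Rightarrow> 'x set \<Rightarrow> 'a \<Rightarrow> 'x list \<Rightarrow> 'x list \<Rightarrow>
    ('x list \<Rightarrow> 'a) \<Rightarrow> ('x list \<Rightarrow> 'a)" where
  "bimul R X c u v f =
    nc_monom R c u \<otimes>\<^bsub>free_algebra R X\<^esub> f \<otimes>\<^bsub>free_algebra R X\<^esub> nc_monom R \<one>\<^bsub>R\<^esub> v"


section \<open>Monomial orderings and leading data\<close>

text \<open>An ordering \<open>r\<close> is a reflexive relation: \<open>(u, v) \<in> r\<close> means that \<open>u\<close> is at most \<open>v\<close>.\<close>

definition monomial_well_order :: "'x set \<Rightarrow> 'x list rel \<Rightarrow> bool" where
  "monomial_well_order X r \<longleftrightarrow> well_order_on (lists X) r \<and>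
    (\<forall>u v. (u, v) \<in> r \<longrightarrow> (\<forall>s\<in>lists X. \<forall>t\<in>lists X. (s @ u @ t, s @ v @ t) \<in> r))"

definition length_compatible :: "'x list rel \<Rightarrow> bool" where
  "length_compatible r \<longleftrightarrow> (\<forall>u v. (u, v) \<in> r \<longrightarrow> length u \<le> length v)"

definition lm :: "('a, 'm) ring_scheme \<Rightarrow> 'x list rel \<Rightarrow> ('x list \<Rightarrow> 'a) \<Rightarrow> 'x list" where
  "lm R r f = (THE u. u \<in> supp R f \<and> (\<forall>v\<in>supp R f. (v, u) \<in> r))"

definition lc :: "('a, 'm) ring_scheme \<Rightarrow> 'x list rel \<Rightarrow> ('x list \<Rightarrow> 'a) \<Rightarrow> 'a" where
  "lc R r f = f (lm R r f)"

definition lt :: "('a, 'm) ring_scheme \<Rightarrow> 'x list rel \<Rightarrow> ('x list \<Rightarrow> 'a) \<Rightarrow> ('x list \<Rightarrow> 'a)" where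
  "lt R r f = nc_monom R (lc R r f) (lm R r f)"

text \<open>
  Divisibility of the leading terms.  Word divisibility is \<open>sublist\<close>; a cofactor of a word over
  \<open>X\<close> is automatically a word over \<open>X\<close>.
\<close>

definition lt_divides :: "('a, 'm) ring_scheme \<Rightarrow> 'x list rel \<Rightarrow>
    ('x list \<Rightarrow> 'a) \<Rightarrow> ('x list \<Rightarrow> 'a) \<Rightarrow> bool" where
  "lt_divides R r g f \<longleftrightarrow> lc R r g divides\<^bsub>R\<^esub> lc R r f \<and> sublist (lm R r g) (lm R r f)"


section \<open>Strong Groebner bases\<close>

definition leading_ideal :: "('a, 'm) ring_scheme \<Rightarrow> 'x set \<Rightarrow> 'x list rel \<Rightarrow>
    ('x list \<Rightarrow> 'a) set \<Rightarrow> ('x list \<Rightarrow> 'a) set" where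
  "leading_ideal R X r S = Idl\<^bsub>free_algebra R X\<^esub> (lt R r ` (S - {\<zero>\<^bsub>free_algebra R X\<^esub>}))"

definition strong_groebner_basis :: "('a, 'm) ring_scheme \<Rightarrow> 'x set \<Rightarrow> 'x list rel \<Rightarrow>
    ('x list \<Rightarrow> 'a) set \<Rightarrow> ('x list \<Rightarrow> 'a) set \<Rightarrow> bool" where
  "strong_groebner_basis R X r G I \<longleftrightarrow>
    I = Idl\<^bsub>free_algebra R X\<^esub> G \<and>
    leading_ideal R X r I \<subseteq> leading_ideal R X r G \<and>
    (\<forall>f\<in>I - {\<zero>\<^bsub>free_algebra R X\<^esub>}. \<exists>g\<in>G. lt_divides R r g f)"


section \<open>Reduction\<close>

text \<open>
  As in \<^locale>\<open>euclidean_domain\<close>, the norm carries no information at zero: the remainder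
  \<open>b'\<close> counts as smaller than the nonzero \<open>lc(f)\<close> whenever \<open>b' = 0\<close>.
\<close>

definition lm_reduces :: "('a, 'm) ring_scheme \<Rightarrow> ('a \<Rightarrow> nat) \<Rightarrow> 'x set \<Rightarrow> 'x list rel \<Rightarrow>
    ('x list \<Rightarrow> 'a) \<Rightarrow> ('x list \<Rightarrow> 'a) \<Rightarrow> ('x list \<Rightarrow> 'a) \<Rightarrow> bool" where
  "lm_reduces R \<phi> X r g f h \<longleftrightarrow>
    f \<noteq> \<zero>\<^bsub>free_algebra R X\<^esub> \<and> g \<noteq> \<zero>\<^bsub>free_algebra R X\<^esub> \<and>
    (\<exists>u\<in>lists X. \<exists>v\<in>lists X. \<exists>a\<in>carrier R - {\<zero>\<^bsub>R\<^esub>}. \<exists>b'\<in>carrier R.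
       lm R r f = u @ lm R r g @ v \<and>
       lc R r f = a \<otimes>\<^bsub>R\<^esub> lc R r g \<oplus>\<^bsub>R\<^esub> b' \<and>
       (b' = \<zero>\<^bsub>R\<^esub> \<or> \<phi> b' < \<phi> (lc R r f)) \<and>
       h = f \<ominus>\<^bsub>free_algebra R X\<^esub> bimul R X a u v g)"

definition reduces_to_zero :: "('a, 'm) ring_scheme \<Rightarrow> ('a \<Rightarrow> nat) \<Rightarrow> 'x set \<Rightarrow> 'x list rel \<Rightarrow>
    ('x list \<Rightarrow> 'a) set \<Rightarrow> ('x list \<Rightarrow> 'a) \<Rightarrow> bool" where
  "reduces_to_zero R \<phi> X r G f \<longleftrightarrow>
    (\<lambda>h h'. \<exists>g\<in>G. lm_reduces R \<phi> X r g h h')\<^sup>*\<^sup>* f \<zero>\<^bsub>free_algebra R X\<^esub>"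


section \<open>S- and G-polynomials\<close>

definition overlap_words :: "'x list \<Rightarrow> 'x list \<Rightarrow> 'x list set" where
  "overlap_words u v = {t. \<exists>t1 t2.
     (t = u @ t1 \<and> t = t2 @ v \<and> length t1 < length v \<and> length t2 < length u) \<or>
     (t = t1 @ u \<and> t = v @ t2 \<and> length t1 < length v \<and> length t2 < length u) \<or>
     (t = t1 @ u @ t2 \<and> t = v) \<or>
     (t = u \<and> t = t1 @ v @ t2)}"

text \<open>
  A choice of Bezout coefficients \<open>bez a b = (b\<^sub>f, b\<^sub>g)\<close> and of lcm cofactors
  \<open>cof a b = (a\<^sub>f, a\<^sub>g)\<close>; the gcd and lcm of two elements are determined up to units only,
  and the choice of Bezout coefficients and cofactors fixes them.
\<close>

definition gcd_lcm_choice :: "('a, 'm) ring_scheme \<Rightarrow>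
    ('a \<Rightarrow> 'a \<Rightarrow> 'a \<times> 'a) \<Rightarrow> ('a \<Rightarrow> 'a \<Rightarrow> 'a \<times> 'a) \<Rightarrow> bool" where
  "gcd_lcm_choice R bez cof \<longleftrightarrow>
    (\<forall>a\<in>carrier R - {\<zero>\<^bsub>R\<^esub>}. \<forall>b\<in>carrier R - {\<zero>\<^bsub>R\<^esub>}.
      (case bez a b of (x, y) \<Rightarrow> x \<in> carrier R \<and> y \<in> carrier R \<and>
         (x \<otimes>\<^bsub>R\<^esub> a \<oplus>\<^bsub>R\<^esub> y \<otimes>\<^bsub>R\<^esub> b) gcdof\<^bsub>R\<^esub> a b) \<and>
      (case cof a b of (x, y) \<Rightarrow> x \<in> carrier R \<and> y \<in> carrier R \<and>
         x \<otimes>\<^bsub>R\<^esub> a = y \<otimes>\<^bsub>R\<^esub> b \<and> (x \<otimes>\<^bsub>R\<^esub> a) lcmof\<^bsub>R\<^esub> a b))"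

definition spolys1 :: "('a, 'm) ring_scheme \<Rightarrow> ('a \<Rightarrow> 'a \<Rightarrow> 'a \<times> 'a) \<Rightarrow> 'x set \<Rightarrow> 'x list rel \<Rightarrow>
    nat \<Rightarrow> ('x list \<Rightarrow> 'a) \<Rightarrow> ('x list \<Rightarrow> 'a) \<Rightarrow> ('x list \<Rightarrow> 'a) set" where
  "spolys1 R cof X r l f g =
    {bimul R X a\<^sub>f u v f \<ominus>\<^bsub>free_algebra R X\<^esub> bimul R X a\<^sub>g u' v' g | a\<^sub>f a\<^sub>g t u v u' v'.
       cof (lc R r f) (lc R r g) = (a\<^sub>f, a\<^sub>g) \<and>
       t \<in> overlap_words (lm R r f) (lm R r g) \<and> length t \<le> l \<and>
       {u, v, u', v'} \<subseteq> lists X \<and> u @ lm R r f @ v = t \<and> u' @ lm R r g @ v' = t}"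

definition gpolys1 :: "('a, 'm) ring_scheme \<Rightarrow> ('a \<Rightarrow> 'a \<Rightarrow> 'a \<times> 'a) \<Rightarrow> 'x set \<Rightarrow> 'x list rel \<Rightarrow>
    nat \<Rightarrow> ('x list \<Rightarrow> 'a) \<Rightarrow> ('x list \<Rightarrow> 'a) \<Rightarrow> ('x list \<Rightarrow> 'a) set" where
  "gpolys1 R bez X r l f g =
    {bimul R X b\<^sub>f u v f \<oplus>\<^bsub>free_algebra R X\<^esub> bimul R X b\<^sub>g u' v' g | b\<^sub>f b\<^sub>g t u v u' v'.
       bez (lc R r f) (lc R r g) = (b\<^sub>f, b\<^sub>g) \<and>
       t \<in> overlap_words (lm R r f) (lm R r g) \<and> length t \<le> l \<and>
       {u, v, u', v'} \<subseteq> lists X \<and> u @ lm R r f @ v = t \<and> u' @ lm R r g @ v' = t}"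

definition spolys2 :: "('a, 'm) ring_scheme \<Rightarrow> ('a \<Rightarrow> 'a \<Rightarrow> 'a \<times> 'a) \<Rightarrow> 'x set \<Rightarrow> 'x list rel \<Rightarrow>
    nat \<Rightarrow> ('x list \<Rightarrow> 'a) \<Rightarrow> ('x list \<Rightarrow> 'a) \<Rightarrow> ('x list \<Rightarrow> 'a) set" where
  "spolys2 R cof X r l f g =
    {bimul R X a\<^sub>f [] (w @ lm R r g) f
       \<ominus>\<^bsub>free_algebra R X\<^esub> bimul R X a\<^sub>g (lm R r f @ w) [] g | a\<^sub>f a\<^sub>g w.
       cof (lc R r f) (lc R r g) = (a\<^sub>f, a\<^sub>g) \<and> w \<in> lists X \<and>
       length (lm R r f) + length w + length (lm R r g) \<le> l}"

definition gpolys2 :: "('a, 'm) ring_scheme \<Rightarrow> ('a \<Rightarrow> 'a \<Rightarrow> 'a \<times> 'a) \<Rightarrow> 'x set \<Rightarrow> 'x list rel \<Rightarrow>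
    nat \<Rightarrow> ('x list \<Rightarrow> 'a) \<Rightarrow> ('x list \<Rightarrow> 'a) \<Rightarrow> ('x list \<Rightarrow> 'a) set" where
  "gpolys2 R bez X r l f g =
    {bimul R X b\<^sub>f [] (w @ lm R r g) f
       \<oplus>\<^bsub>free_algebra R X\<^esub> bimul R X b\<^sub>g (lm R r f @ w) [] g | b\<^sub>f b\<^sub>g w.
       bez (lc R r f) (lc R r g) = (b\<^sub>f, b\<^sub>g) \<and> w \<in> lists X \<and>
       length (lm R r f) + length w + length (lm R r g) \<le> l}"

text \<open>Buchberger's algorithm up to length \<open>l\<close> adds nothing to \<open>G\<close>.\<close>

definition no_new_polynomials :: "('a, 'm) ring_scheme \<Rightarrow> ('a \<Rightarrow> nat) \<Rightarrow>
    ('a \<Rightarrow> 'a \<Rightarrow> 'a \<times> 'a) \<Rightarrow> ('a \<Rightarrow> 'a \<Rightarrow> 'a \<times> 'a) \<Rightarrow> 'x set \<Rightarrow> 'x list rel \<Rightarrow>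
    nat \<Rightarrow> ('x list \<Rightarrow> 'a) set \<Rightarrow> bool" where
  "no_new_polynomials R \<phi> bez cof X r l G \<longleftrightarrow>
    (\<forall>f\<in>G. \<forall>g\<in>G. \<forall>h \<in> spolys1 R cof X r l f g \<union> gpolys1 R bez X r l f g \<union>
                            spolys2 R cof X r l f g \<union> gpolys2 R bez X r l f g.
       reduces_to_zero R \<phi> X r G h)"


section \<open>The free algebra is a ring\<close>

lemma free_algebra_simps:
  "f \<in> carrier (free_algebra R X) \<longleftrightarrow>
     range f \<subseteq> carrier R \<and> finite (supp R f) \<and> supp R f \<subseteq> lists X"
  "(f \<otimes>\<^bsub>free_algebra R X\<^esub> g) =
     (\<lambda>w. \<Oplus>\<^bsub>R\<^esub>i\<in>{..length w}. f (take i w) \<otimes>\<^bsub>R\<^esub> g (drop i w))"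
  "\<one>\<^bsub>free_algebra R X\<^esub> = nc_monom R \<one>\<^bsub>R\<^esub> []"
  "\<zero>\<^bsub>free_algebra R X\<^esub> = (\<lambda>w. \<zero>\<^bsub>R\<^esub>)"
  "(f \<oplus>\<^bsub>free_algebra R X\<^esub> g) = (\<lambda>w. f w \<oplus>\<^bsub>R\<^esub> g w)"
  by (simp_all add: free_algebra_def)

lemma (in abelian_monoid) finsum_triangle:
  assumes "\<And>j i. A j i \<in> carrier G"
  shows "(\<Oplus>i\<in>{..n::nat}. \<Oplus>j\<in>{..i}. A j i) = (\<Oplus>j\<in>{..n}. \<Oplus>k\<in>{..n - j}. A j (j + k))"
proof (induction n)
  case 0
  show ?case using assms by simp
next
  case (Suc n)
  have "(\<Oplus>j\<in>{..n}. \<Oplus>k\<in>{..Suc n - j}. A j (j + k))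
      = (\<Oplus>j\<in>{..n}. A j (Suc n) \<oplus> (\<Oplus>k\<in>{..n - j}. A j (j + k)))"
    using assms by (intro finsum_cong') (auto simp: Suc_diff_le)
  also have "\<dots> = (\<Oplus>j\<in>{..n}. A j (Suc n)) \<oplus> (\<Oplus>j\<in>{..n}. \<Oplus>k\<in>{..n - j}. A j (j + k))"
    using assms by (intro finsum_addf) auto
  finally show ?case
    using assms Suc by (simp add: a_ac)
qed

lemma free_algebra_ring:
  fixes R (structure) and X :: "'x set"
  assumes "ring R"
  shows "ring (free_algebra R X)"
proof -
  interpret ring R by fact
  let ?P = "free_algebra R X"
  have coeff: "f w \<in> carrier R" if "f \<in> carrier ?P" for f w
    using that by (auto simp: free_algebra_simps)
  have supp: "finite (supp R f)" "supp R f \<subseteq> lists X" if "f \<in> carrier ?P" for f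
    using that unfolding free_algebra_simps by blast+
  have carrierI: "h \<in> carrier ?P"
    if "\<And>w. h w \<in> carrier R" "supp R h \<subseteq> S" "finite S" "S \<subseteq> lists X" for h S
    using that unfolding free_algebra_simps by (meson finite_subset image_subsetI order_trans)
  have add_group: "abelian_group ?P"
  proof (rule abelian_groupI)
    fix f g assume fg: "f \<in> carrier ?P" "g \<in> carrier ?P"
    show "f \<oplus>\<^bsub>?P\<^esub> g \<in> carrier ?P"
      unfolding free_algebra_simps(5)
    proof (rule carrierI[where S = "supp R f \<union> supp R g"])
      show "supp R (\<lambda>w. f w \<oplus> g w) \<subseteq> supp R f \<union> supp R g"
        by (auto simp: supp_def)
    qed (use fg in \<open>simp_all add: coeff supp\<close>)
    show "f \<oplus>\<^bsub>?P\<^esub> g = g \<oplus>\<^bsub>?P\<^esub> f"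
      using fg by (auto simp: free_algebra_simps(5) coeff a_comm)
  next
    fix f assume f: "f \<in> carrier ?P"
    have "(\<lambda>w. \<ominus> f w) \<in> carrier ?P"
    proof (rule carrierI[where S = "supp R f"])
      show "supp R (\<lambda>w. \<ominus> f w) \<subseteq> supp R f"
        by (auto simp: supp_def)
    qed (use f in \<open>simp_all add: coeff supp\<close>)
    moreover have "(\<lambda>w. \<ominus> f w) \<oplus>\<^bsub>?P\<^esub> f = \<zero>\<^bsub>?P\<^esub>"
      using f by (auto simp: free_algebra_simps(4,5) coeff l_neg)
    ultimately show "\<exists>g\<in>carrier ?P. g \<oplus>\<^bsub>?P\<^esub> f = \<zero>\<^bsub>?P\<^esub>" by blast
    show "\<zero>\<^bsub>?P\<^esub> \<oplus>\<^bsub>?P\<^esub> f = f"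
      using f by (auto simp: free_algebra_simps(4,5) coeff)
  qed (auto simp: free_algebra_simps(4,5) coeff a_assoc, auto simp: free_algebra_simps supp_def)
  have "monoid ?P"
  proof (rule monoidI)
    fix f g assume f: "f \<in> carrier ?P" and g: "g \<in> carrier ?P"
    have sub: "supp R (f \<otimes>\<^bsub>?P\<^esub> g) \<subseteq> (\<lambda>(u, v). u @ v) ` (supp R f \<times> supp R g)"
    proof
      fix w assume w: "w \<in> supp R (f \<otimes>\<^bsub>?P\<^esub> g)"
      have "\<exists>i\<le>length w. f (take i w) \<otimes> g (drop i w) \<noteq> \<zero>"
      proof (rule ccontr)
        assume "\<not> ?thesis"
        then have "(\<Oplus>i\<in>{..length w}. f (take i w) \<otimes> g (drop i w)) = (\<Oplus>i\<in>{..length w}. \<zero>)"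
          by (intro finsum_cong') auto
        then show False using w by (simp add: supp_def free_algebra_simps(2))
      qed
      then obtain i where "f (take i w) \<noteq> \<zero>" "g (drop i w) \<noteq> \<zero>"
        using f g by (metis coeff l_null r_null)
      then show "w \<in> (\<lambda>(u, v). u @ v) ` (supp R f \<times> supp R g)"
        by (auto simp: supp_def intro!: image_eqI[of _ _ "(take i w, drop i w)"])
    qed
    show "f \<otimes>\<^bsub>?P\<^esub> g \<in> carrier ?P"
    proof (rule carrierI[OF _ sub])
      show "(f \<otimes>\<^bsub>?P\<^esub> g) w \<in> carrier R" for w
        using f g by (auto simp: free_algebra_simps(2) coeff)
      show "(\<lambda>(u, v). u @ v) ` (supp R f \<times> supp R g) \<subseteq> lists X"
        using supp(2)[OF f] supp(2)[OF g] by fastforce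
    qed (use f g in \<open>simp add: supp\<close>)
  next
    show "\<one>\<^bsub>?P\<^esub> \<in> carrier ?P"
      by (rule carrierI[where S = "{[]}"]) (auto simp: free_algebra_simps(3) supp_def nc_monom_def)
  next
    fix f g h assume f: "f \<in> carrier ?P" and g: "g \<in> carrier ?P" and h: "h \<in> carrier ?P"
    show "f \<otimes>\<^bsub>?P\<^esub> g \<otimes>\<^bsub>?P\<^esub> h = f \<otimes>\<^bsub>?P\<^esub> (g \<otimes>\<^bsub>?P\<^esub> h)"
    proof
      fix w :: "'x list"
      let ?n = "length w"
      let ?A = "\<lambda>j i. f (take j w) \<otimes> (g (drop j (take i w)) \<otimes> h (drop i w))"
      have "(f \<otimes>\<^bsub>?P\<^esub> g \<otimes>\<^bsub>?P\<^esub> h) w = (\<Oplus>i\<in>{..?n}. \<Oplus>j\<in>{..i}. ?A j i)"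
        unfolding free_algebra_simps(2)
        using f g h by (intro finsum_cong')
          (auto simp: coeff finsum_ldistr m_assoc min_absorb1 min_absorb2 intro!: finsum_cong')
      also have "\<dots> = (\<Oplus>j\<in>{..?n}. \<Oplus>k\<in>{..?n - j}. ?A j (j + k))"
        using f g h by (intro finsum_triangle) (auto simp: coeff)
      also have "\<dots> = (f \<otimes>\<^bsub>?P\<^esub> (g \<otimes>\<^bsub>?P\<^esub> h)) w"
        unfolding free_algebra_simps(2)
        using f g h by (intro finsum_cong')
          (auto simp: coeff finsum_rdistr drop_take add.commute intro!: finsum_cong')
      finally show "(f \<otimes>\<^bsub>?P\<^esub> g \<otimes>\<^bsub>?P\<^esub> h) w = (f \<otimes>\<^bsub>?P\<^esub> (g \<otimes>\<^bsub>?P\<^esub> h)) w" .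
    qed
  next
    fix f assume f: "f \<in> carrier ?P"
    show "\<one>\<^bsub>?P\<^esub> \<otimes>\<^bsub>?P\<^esub> f = f"
    proof
      fix w :: "'x list"
      have "(\<one>\<^bsub>?P\<^esub> \<otimes>\<^bsub>?P\<^esub> f) w = (\<Oplus>i\<in>{..length w}. if 0 = i then f (drop i w) else \<zero>)"
        unfolding free_algebra_simps(2,3)
        using f by (intro finsum_cong') (auto simp: nc_monom_def coeff)
      also have "\<dots> = f w"
        using f by (subst add.finprod_singleton) (auto simp: coeff)
      finally show "(\<one>\<^bsub>?P\<^esub> \<otimes>\<^bsub>?P\<^esub> f) w = f w" .
    qed
    show "f \<otimes>\<^bsub>?P\<^esub> \<one>\<^bsub>?P\<^esub> = f"
    proof
      fix w :: "'x list"
      have "(f \<otimes>\<^bsub>?P\<^esub> \<one>\<^bsub>?P\<^esub>) w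
          = (\<Oplus>i\<in>{..length w}. if length w = i then f (take i w) else \<zero>)"
        unfolding free_algebra_simps(2,3)
        using f by (intro finsum_cong') (auto simp: nc_monom_def coeff)
      also have "\<dots> = f w"
        using f by (subst add.finprod_singleton) (auto simp: coeff)
      finally show "(f \<otimes>\<^bsub>?P\<^esub> \<one>\<^bsub>?P\<^esub>) w = f w" .
    qed
  qed
  then show ?thesis
  proof (intro ringI add_group)
    fix f g h assume "f \<in> carrier ?P" "g \<in> carrier ?P" "h \<in> carrier ?P"
    note c = this[THEN coeff]
    show "(f \<oplus>\<^bsub>?P\<^esub> g) \<otimes>\<^bsub>?P\<^esub> h = f \<otimes>\<^bsub>?P\<^esub> h \<oplus>\<^bsub>?P\<^esub> g \<otimes>\<^bsub>?P\<^esub> h"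
      unfolding free_algebra_simps(2,5)
      using c by (auto simp: l_distr finsum_addf)
    show "h \<otimes>\<^bsub>?P\<^esub> (f \<oplus>\<^bsub>?P\<^esub> g) = h \<otimes>\<^bsub>?P\<^esub> f \<oplus>\<^bsub>?P\<^esub> h \<otimes>\<^bsub>?P\<^esub> g"
      unfolding free_algebra_simps(2,5)
      using c by (auto simp: r_distr finsum_addf)
  qed
qed

end

theory Submission
  imports Defs "HOL-Library.Nat_Bijection"
begin

text \<open>
  Over the integers the polynomials \<open>2 a\<close> and \<open>3 b\<close>, with letters \<open>a \<noteq> b\<close>, have
  second type G-polynomials that are multiples of \<open>a w b\<close> for every word \<open>w\<close>: the monomials
  \<open>a w b = (a w) (3 b) - (2 a) (w b)\<close> all lie in the ideal, but neither \<open>2\<close> nor \<open>3\<close>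
  divides their coefficient \<open>1\<close>.  Hence a strong Groebner basis that contains \<open>2 a\<close> and
  \<open>3 b\<close> needs further leading terms that take care of each \<open>w\<close>.  Adding monic monomials
  \<open>m \<in> M\<close> that occur in all \<open>a w b\<close> with \<open>w\<close> short, but not in one particular long
  \<open>a w b\<close>, yields a set on which Buchberger's algorithm is silent up to a large length although
  the set is not a strong Groebner basis.

  Everything in sight is a monomial.  Therefore all S-polynomials vanish and every G-polynomial is a
  monomial, which reduces to zero as soon as a single leading term divides it.  This is automatic
  unless the pair is \<open>2 a\<close>, \<open>3 b\<close>, and then the word contains both letters and \<open>M\<close>
  is responsible for it (\<open>no_new_polynomials_two_letters\<close>,
  \<open>not_strong_groebner_basis_two_letters\<close>).

  To make the missed word long, take distinct letters \<open>e\<^sub>0, \<dots>, e\<^sub>n\<close> with \<open>a = e\<^sub>0\<close>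
  and \<open>b = e\<^sub>n\<close>, and let \<open>M\<close> consist of all two-letter words \<open>e\<^sub>i e\<^sub>j\<close> with
  \<open>j \<noteq> i + 1\<close>.  A word that avoids \<open>M\<close> runs along the path \<open>e\<^sub>0 e\<^sub>1 \<dots> e\<^sub>n\<close>, so if
  it contains both ends then it is at least as long as the whole path
  (\<open>long_if_both_ends_and_no_off_path_pair\<close>).  Since the alphabet may be chosen after \<open>b\<close>,
  the path can be made longer than \<open>b d\<close>; words of length 2 suffice for this, so for
  \<open>d \<ge> 2\<close> no value of \<open>b d\<close> at all is possible.  For \<open>d = 1\<close> the set \<open>M\<close> is empty
  and the path has two letters, which refutes \<open>b 1 \<le> 1\<close>; for \<open>d = 0\<close> the bound is trivial.
\<close>


section \<open>Monomials in the free algebra\<close>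

lemma nc_monom_add:
  assumes "ring R" and "c \<in> carrier R" and "d \<in> carrier R"
  shows "nc_monom R c w \<oplus>\<^bsub>free_algebra R X\<^esub> nc_monom R d w = nc_monom R (c \<oplus>\<^bsub>R\<^esub> d) w"
proof -
  interpret ring R by fact
  show ?thesis
    using assms(2,3) by (auto simp: free_algebra_simps nc_monom_def)
qed

lemma nc_monom_mult:
  fixes u v :: "'x list"
  assumes "ring R" and "c \<in> carrier R" and "d \<in> carrier R"
  shows "nc_monom R c u \<otimes>\<^bsub>free_algebra R X\<^esub> nc_monom R d v = nc_monom R (c \<otimes>\<^bsub>R\<^esub> d) (u @ v)"
proof
  interpret ring R by fact
  fix w :: "'x list"
  have "nc_monom R c u (take i w) \<otimes>\<^bsub>R\<^esub> nc_monom R d v (drop i w)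
      = (if length u = i then nc_monom R (c \<otimes>\<^bsub>R\<^esub> d) (u @ v) w else \<zero>\<^bsub>R\<^esub>)"
    if "i \<le> length w" for i
  proof (cases "w = u @ v")
    case True
    have "take i w = u \<longleftrightarrow> length u = i"
      using that True by (metis append_eq_conv_conj length_take min.absorb2)
    with True show ?thesis
      using assms(2,3) by (auto simp: nc_monom_def)
  next
    case False
    then have "take i w \<noteq> u \<or> drop i w \<noteq> v"
      by (metis append_take_drop_id)
    with False show ?thesis
      using assms(2,3) by (auto simp: nc_monom_def)
  qed
  then have "(nc_monom R c u \<otimes>\<^bsub>free_algebra R X\<^esub> nc_monom R d v) w
      = (\<Oplus>\<^bsub>R\<^esub>i\<in>{..length w}. if length u = i then nc_monom R (c \<otimes>\<^bsub>R\<^esub> d) (u @ v) w else \<zero>\<^bsub>R\<^esub>)"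
    unfolding free_algebra_simps(2)
    using assms(2,3) by (intro finsum_cong') (auto simp: nc_monom_def)
  also have "\<dots> = nc_monom R (c \<otimes>\<^bsub>R\<^esub> d) (u @ v) w"
  proof (cases "length u \<le> length w")
    case True
    then show ?thesis
      using assms(2,3) by (subst add.finprod_singleton) (auto simp: nc_monom_def)
  next
    case False
    then have "(\<Oplus>\<^bsub>R\<^esub>i\<in>{..length w}. if length u = i then nc_monom R (c \<otimes>\<^bsub>R\<^esub> d) (u @ v) w else \<zero>\<^bsub>R\<^esub>)
        = (\<Oplus>\<^bsub>R\<^esub>i\<in>{..length w}. \<zero>\<^bsub>R\<^esub>)"
      by (intro finsum_cong') auto
    also have "\<dots> = nc_monom R (c \<otimes>\<^bsub>R\<^esub> d) (u @ v) w"
      using False by (auto simp: nc_monom_def)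
    finally show ?thesis .
  qed
  finally show "(nc_monom R c u \<otimes>\<^bsub>free_algebra R X\<^esub> nc_monom R d v) w
      = nc_monom R (c \<otimes>\<^bsub>R\<^esub> d) (u @ v) w" .
qed

lemma bimul_nc_monom:
  assumes "ring R" and "a \<in> carrier R" and "c \<in> carrier R"
  shows "bimul R X a u v (nc_monom R c w) = nc_monom R (a \<otimes>\<^bsub>R\<^esub> c) (u @ w @ v)"
proof -
  interpret ring R by fact
  show ?thesis
    using assms(2,3) by (simp add: bimul_def nc_monom_mult[OF assms(1)])
qed

lemma nc_monom_in_carrier:
  assumes "ring R" and "c \<in> carrier R" and "w \<in> lists X"
  shows "nc_monom R c w \<in> carrier (free_algebra R X)"
proof -
  interpret ring R by fact
  have "supp R (nc_monom R c w) \<subseteq> {w}"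
    by (auto simp: supp_def nc_monom_def)
  then show ?thesis
    using assms(2,3) unfolding free_algebra_simps
    by (auto simp: nc_monom_def intro: finite_subset)
qed

lemma nc_monom_zero: "nc_monom R \<zero>\<^bsub>R\<^esub> w = \<zero>\<^bsub>free_algebra R X\<^esub>"
  by (auto simp: nc_monom_def free_algebra_simps)

lemma nc_monom_eq_zero_iff: "nc_monom R c w = \<zero>\<^bsub>free_algebra R X\<^esub> \<longleftrightarrow> c = \<zero>\<^bsub>R\<^esub>"
  by (auto simp: nc_monom_def free_algebra_simps fun_eq_iff)

lemma supp_nc_monom: "c \<noteq> \<zero>\<^bsub>R\<^esub> \<Longrightarrow> supp R (nc_monom R c w) = {w}"
  by (auto simp: supp_def nc_monom_def)

lemma lm_nc_monom:
  assumes "c \<noteq> \<zero>\<^bsub>R\<^esub>" and "(w, w) \<in> r"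
  shows "lm R r (nc_monom R c w) = w"
  using assms by (auto simp: lm_def supp_nc_monom intro!: the_equality)

lemma lc_nc_monom:
  assumes "c \<noteq> \<zero>\<^bsub>R\<^esub>" and "(w, w) \<in> r"
  shows "lc R r (nc_monom R c w) = c"
  using assms by (simp add: lc_def lm_nc_monom) (simp add: nc_monom_def)

lemma monomial_well_order_refl:
  assumes "monomial_well_order X r" and "w \<in> lists X"
  shows "(w, w) \<in> r"
  using assms by (auto simp: monomial_well_order_def order_on_defs dest: refl_onD)


section \<open>Buchberger's algorithm on a set of monomials\<close>

definition monomials :: "('a, 'm) ring_scheme \<Rightarrow> ('a \<times> 'x list) set \<Rightarrow> ('x list \<Rightarrow> 'a) set" where
  "monomials R T = (\<lambda>(c, u). nc_monom R c u) ` T"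

text \<open>
  One step suffices, because the division of the coefficients is exact: the remainder is \<open>0\<close>.
  The case \<open>k = 0\<close> is separate, since a reduction step has a nonzero quotient.
\<close>

lemma monomial_reduces_to_zero:
  assumes R: "ring R" and r: "monomial_well_order X r"
    and cu: "(c, u) \<in> T" "c \<in> carrier R" "c \<noteq> \<zero>\<^bsub>R\<^esub>"
    and t: "t \<in> lists X" "sublist u t"
    and k: "k = a \<otimes>\<^bsub>R\<^esub> c" "a \<in> carrier R"
  shows "reduces_to_zero R \<phi> X r (monomials R T) (nc_monom R k t)"
proof (cases "k = \<zero>\<^bsub>R\<^esub>")
  case True
  then show ?thesis
    by (simp add: reduces_to_zero_def nc_monom_zero[where X = X])
next
  case False
  interpret ring R by fact
  interpret P: ring "free_algebra R X"
    using R by (rule free_algebra_ring)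
  obtain x y where xy: "t = x @ u @ y"
    using t(2) by (auto simp: sublist_def)
  then have words: "x \<in> lists X" "y \<in> lists X" "u \<in> lists X"
    using t(1) by auto
  note refl = monomial_well_order_refl[OF r]
  have "nc_monom R k t \<in> carrier (free_algebra R X)"
    using k cu t by (simp add: nc_monom_in_carrier[OF R])
  then have "nc_monom R k t \<ominus>\<^bsub>free_algebra R X\<^esub> bimul R X a x y (nc_monom R c u) = \<zero>\<^bsub>free_algebra R X\<^esub>"
    using k cu by (simp add: bimul_nc_monom[OF R] xy P.minus_eq P.r_neg)
  moreover have "a \<noteq> \<zero>\<^bsub>R\<^esub>"
    using False k cu by auto
  ultimately have "lm_reduces R \<phi> X r (nc_monom R c u) (nc_monom R k t) \<zero>\<^bsub>free_algebra R X\<^esub>"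
    unfolding lm_reduces_def
  proof (intro conjI bexI)
    show "lm R r (nc_monom R k t) = x @ lm R r (nc_monom R c u) @ y"
      using False cu refl t(1) words xy by (simp add: lm_nc_monom)
    show "lc R r (nc_monom R k t) = a \<otimes>\<^bsub>R\<^esub> lc R r (nc_monom R c u) \<oplus>\<^bsub>R\<^esub> \<zero>\<^bsub>R\<^esub>"
      using False cu k refl t(1) words by (simp add: lc_nc_monom)
  qed (use False cu k words in \<open>simp_all add: nc_monom_eq_zero_iff\<close>)
  moreover have "nc_monom R c u \<in> monomials R T"
    using cu by (force simp: monomials_def)
  ultimately show ?thesis
    unfolding reduces_to_zero_def by blast
qed

text \<open>
  Both terms of an S- or G-polynomial of two monomials are multiples of the same word \<open>t\<close>, of
  which both leading words are factors.  In an S-polynomial they cancel.  A G-polynomial is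
  \<open>x c + y c'\<close> times \<open>t\<close> with Bezout coefficients \<open>x\<close> and \<open>y\<close>, so the
  hypothesis on divisibility is what a one-step reduction requires.  It allows arbitrary \<open>x\<close> and
  \<open>y\<close>, so the result holds for every choice of Bezout coefficients.
\<close>

lemma no_new_polynomials_monomials:
  assumes R: "ring R" and r: "monomial_well_order X r" and choice: "gcd_lcm_choice R bez cof"
    and T: "T \<subseteq> (carrier R - {\<zero>\<^bsub>R\<^esub>}) \<times> lists X"
    and divisible: "\<And>c u c' u' t x y. \<lbrakk> (c, u) \<in> T; (c', u') \<in> T;
        t \<in> lists X; length t \<le> l; sublist u t; sublist u' t; x \<in> carrier R; y \<in> carrier R \<rbrakk> \<Longrightarrow>
      \<exists>(c'', u'')\<in>T. sublist u'' t \<and>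
        (\<exists>a\<in>carrier R. x \<otimes>\<^bsub>R\<^esub> c \<oplus>\<^bsub>R\<^esub> y \<otimes>\<^bsub>R\<^esub> c' = a \<otimes>\<^bsub>R\<^esub> c'')"
  shows "no_new_polynomials R \<phi> bez cof X r l (monomials R T)"
  unfolding no_new_polynomials_def
proof (intro ballI)
  interpret ring R by fact
  interpret P: ring "free_algebra R X"
    using R by (rule free_algebra_ring)
  fix f g h
  assume "f \<in> monomials R T" and "g \<in> monomials R T"
    and h: "h \<in> spolys1 R cof X r l f g \<union> gpolys1 R bez X r l f g \<union>
               spolys2 R cof X r l f g \<union> gpolys2 R bez X r l f g"
  then obtain c u c' u'
    where f: "f = nc_monom R c u" "(c, u) \<in> T" and g: "g = nc_monom R c' u'" "(c', u') \<in> T"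
    by (auto simp: monomials_def)
  have c: "c \<in> carrier R" "c \<noteq> \<zero>\<^bsub>R\<^esub>" "c' \<in> carrier R" "c' \<noteq> \<zero>\<^bsub>R\<^esub>"
    and u: "u \<in> lists X" "u' \<in> lists X"
    using f g T by auto
  note refl = monomial_well_order_refl[OF r]
  have lead: "lm R r f = u" "lc R r f = c" "lm R r g = u'" "lc R r g = c'"
    using c u refl by (simp_all add: f g lm_nc_monom lc_nc_monom)
  have cof: "x \<in> carrier R \<and> y \<in> carrier R \<and> x \<otimes>\<^bsub>R\<^esub> c = y \<otimes>\<^bsub>R\<^esub> c'" if "cof c c' = (x, y)" for x y
    using choice[unfolded gcd_lcm_choice_def, rule_format, of c c'] c that by auto
  have bez: "x \<in> carrier R \<and> y \<in> carrier R" if "bez c c' = (x, y)" for x y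
    using choice[unfolded gcd_lcm_choice_def, rule_format, of c c'] c that by auto
  have spoly: "bimul R X x p q f \<ominus>\<^bsub>free_algebra R X\<^esub> bimul R X y p' q' g = \<zero>\<^bsub>free_algebra R X\<^esub>"
    if "cof c c' = (x, y)" "p @ u @ q = t" "p' @ u' @ q' = t" "t \<in> lists X" for x y p q p' q' t
  proof -
    have "nc_monom R (x \<otimes>\<^bsub>R\<^esub> c) t \<in> carrier (free_algebra R X)"
      using cof[OF that(1)] c that(4) by (intro nc_monom_in_carrier[OF R]) auto
    then show ?thesis
      using cof[OF that(1)] c that
      by (simp add: f g bimul_nc_monom[OF R] P.minus_eq P.r_neg)
  qed
  have gpoly: "reduces_to_zero R \<phi> X r (monomials R T)
      (bimul R X x p q f \<oplus>\<^bsub>free_algebra R X\<^esub> bimul R X y p' q' g)"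
    if "bez c c' = (x, y)" "p @ u @ q = t" "p' @ u' @ q' = t" "t \<in> lists X" "length t \<le> l"
    for x y p q p' q' t
  proof -
    have xy: "x \<in> carrier R" "y \<in> carrier R"
      using bez[OF that(1)] by auto
    note t = that(4,5)
    have "sublist u t" "sublist u' t"
      using that(2,3) unfolding sublist_def by metis+
    then obtain c'' u'' a where "(c'', u'') \<in> T" "sublist u'' t" "a \<in> carrier R"
        "x \<otimes>\<^bsub>R\<^esub> c \<oplus>\<^bsub>R\<^esub> y \<otimes>\<^bsub>R\<^esub> c' = a \<otimes>\<^bsub>R\<^esub> c''"
      using divisible[OF f(2) g(2) t] xy by blast
    then have "reduces_to_zero R \<phi> X r (monomials R T) (nc_monom R (x \<otimes>\<^bsub>R\<^esub> c \<oplus>\<^bsub>R\<^esub> y \<otimes>\<^bsub>R\<^esub> c') t)"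
      using T t by (intro monomial_reduces_to_zero[OF R r]) auto
    then show ?thesis
      using xy c that(2,3) by (simp add: f g bimul_nc_monom[OF R] nc_monom_add[OF R])
  qed
  have zero: "reduces_to_zero R \<phi> X r (monomials R T) \<zero>\<^bsub>free_algebra R X\<^esub>"
    by (simp add: reduces_to_zero_def)
  from h consider
      "h \<in> spolys1 R cof X r l f g" | "h \<in> gpolys1 R bez X r l f g"
    | "h \<in> spolys2 R cof X r l f g" | "h \<in> gpolys2 R bez X r l f g"
    by blast
  then show "reduces_to_zero R \<phi> X r (monomials R T) h"
  proof cases
    case 1
    then obtain x y t p q p' q' where
      "h = bimul R X x p q f \<ominus>\<^bsub>free_algebra R X\<^esub> bimul R X y p' q' g" "cof c c' = (x, y)"
      "{p, q, p', q'} \<subseteq> lists X" "p @ u @ q = t" "p' @ u' @ q' = t"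
      unfolding spolys1_def lead by (elim CollectE exE conjE)
    moreover from this have "t \<in> lists X"
      using u by auto
    ultimately show ?thesis
      using spoly[of x y p q t p' q'] zero by simp
  next
    case 2
    then obtain x y t p q p' q' where
      "h = bimul R X x p q f \<oplus>\<^bsub>free_algebra R X\<^esub> bimul R X y p' q' g" "bez c c' = (x, y)"
      "{p, q, p', q'} \<subseteq> lists X" "p @ u @ q = t" "p' @ u' @ q' = t" "length t \<le> l"
      unfolding gpolys1_def lead by (elim CollectE exE conjE)
    moreover from this have "t \<in> lists X"
      using u by auto
    ultimately show ?thesis
      using gpoly[of x y p q t p' q'] by simp
  next
    case 3
    then obtain x y w where
      "h = bimul R X x [] (w @ u') f \<ominus>\<^bsub>free_algebra R X\<^esub> bimul R X y (u @ w) [] g"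
      "cof c c' = (x, y)" "w \<in> lists X"
      unfolding spolys2_def lead by (elim CollectE exE conjE)
    then show ?thesis
      using spoly[of x y "[]" "w @ u'" "u @ w @ u'" "u @ w" "[]"] u zero by simp
  next
    case 4
    then obtain x y w where
      "h = bimul R X x [] (w @ u') f \<oplus>\<^bsub>free_algebra R X\<^esub> bimul R X y (u @ w) [] g"
      "bez c c' = (x, y)" "w \<in> lists X" "length u + length w + length u' \<le> l"
      unfolding gpolys2_def lead by (elim CollectE exE conjE)
    then show ?thesis
      using gpoly[of x y "[]" "w @ u'" "u @ w @ u'" "u @ w" "[]"] u by simp
  qed
qed


section \<open>Two letters with comaximal coefficients\<close>

definition two_letter_terms ::
  "('a, 'm) ring_scheme \<Rightarrow> 'a \<Rightarrow> 'x \<Rightarrow> 'a \<Rightarrow> 'x \<Rightarrow> 'x list set \<Rightarrow> ('a \<times> 'x list) set" where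
  "two_letter_terms R \<alpha> a \<beta> b M = insert (\<alpha>, [a]) (insert (\<beta>, [b]) (Pair \<one>\<^bsub>R\<^esub> ` M))"

text \<open>
  If one of the two coefficients is \<open>1\<close>, then that polynomial divides the G-polynomial; if both
  polynomials have the same coefficient, then \<open>x c + y c\<close> is a multiple of it.  The only
  remaining pair is \<open>\<alpha> a\<close> and \<open>\<beta> b\<close>, where \<open>t\<close> contains both letters and
  the hypothesis on short words applies.
\<close>

lemma no_new_polynomials_two_letters:
  assumes R: "domain R" and r: "monomial_well_order X r" and choice: "gcd_lcm_choice R bez cof"
    and coeffs: "\<alpha> \<in> carrier R - {\<zero>\<^bsub>R\<^esub>}" "\<beta> \<in> carrier R - {\<zero>\<^bsub>R\<^esub>}"
    and words: "a \<in> X" "b \<in> X" "M \<subseteq> lists X"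
    and short: "\<And>t. \<lbrakk> t \<in> lists X; length t \<le> l; a \<in> set t; b \<in> set t \<rbrakk> \<Longrightarrow> \<exists>m\<in>M. sublist m t"
  shows "no_new_polynomials R \<phi> bez cof X r l (monomials R (two_letter_terms R \<alpha> a \<beta> b M))"
    (is "no_new_polynomials _ _ _ _ _ _ _ (monomials R ?T)")
proof -
  interpret domain R by fact
  show ?thesis
  proof (rule no_new_polynomials_monomials[OF ring_axioms r choice])
    show "?T \<subseteq> (carrier R - {\<zero>\<^bsub>R\<^esub>}) \<times> lists X"
      using coeffs words by (auto simp: two_letter_terms_def)
  next
    fix c u c' u' t x y
    assume cu: "(c, u) \<in> ?T" and cu': "(c', u') \<in> ?T"
      and t: "t \<in> lists X" "length t \<le> l" "sublist u t" "sublist u' t"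
      and xy: "x \<in> carrier R" "y \<in> carrier R"
    have c: "c \<in> carrier R" "c' \<in> carrier R"
      using cu cu' coeffs by (auto simp: two_letter_terms_def)
    let ?k = "x \<otimes>\<^bsub>R\<^esub> c \<oplus>\<^bsub>R\<^esub> y \<otimes>\<^bsub>R\<^esub> c'"
    have k: "?k \<in> carrier R"
      using xy c by simp
    let ?reducible = "\<exists>(c'', u'')\<in>?T. sublist u'' t \<and> (\<exists>a\<in>carrier R. ?k = a \<otimes>\<^bsub>R\<^esub> c'')"
    have monic: ?reducible if "(\<one>\<^bsub>R\<^esub>, m) \<in> ?T" "sublist m t" for m
      using that k by (intro bexI[of _ "(\<one>\<^bsub>R\<^esub>, m)"]) (auto intro: bexI[of _ ?k])
    have letter: "z \<in> set t" if "sublist [z] t" for z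
      using that by (auto simp: sublist_def)
    have mixed: ?reducible if "a \<in> set t" "b \<in> set t"
      using short[OF t(1,2) that] monic by (auto simp: two_letter_terms_def)
    have same: ?reducible if "c = c'"
      using that xy c cu t(3) l_distr[of x y c, symmetric]
      by (intro bexI[of _ "(c, u)"]) (auto intro: bexI[of _ "x \<oplus>\<^bsub>R\<^esub> y"])
    consider "c = \<one>\<^bsub>R\<^esub>" | "c' = \<one>\<^bsub>R\<^esub>" | "c = c'" | "a \<in> set t \<and> b \<in> set t"
      using cu cu' t(3,4) letter by (auto simp: two_letter_terms_def)
    then show ?reducible
      using cu cu' t(3,4) monic mixed same by cases auto
  qed
qed

text \<open>
  The witness is the monic monomial \<open>a w b\<close>, which lies in the ideal by
  \<open>a w b = (\<alpha> a) (\<sigma> w b) + (\<tau> a w) (\<beta> b)\<close>.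
\<close>

lemma not_strong_groebner_basis_two_letters:
  assumes R: "domain R" and r: "monomial_well_order X r"
    and coeffs: "\<alpha> \<in> carrier R - {\<zero>\<^bsub>R\<^esub>}" "\<beta> \<in> carrier R - {\<zero>\<^bsub>R\<^esub>}"
    and nonunits: "\<not> \<alpha> divides\<^bsub>R\<^esub> \<one>\<^bsub>R\<^esub>" "\<not> \<beta> divides\<^bsub>R\<^esub> \<one>\<^bsub>R\<^esub>"
    and comaximal: "\<one>\<^bsub>R\<^esub> = \<sigma> \<otimes>\<^bsub>R\<^esub> \<alpha> \<oplus>\<^bsub>R\<^esub> \<tau> \<otimes>\<^bsub>R\<^esub> \<beta>" "\<sigma> \<in> carrier R" "\<tau> \<in> carrier R"
    and words: "a \<in> X" "b \<in> X" "w \<in> lists X" "M \<subseteq> lists X"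
    and avoid: "\<And>m. m \<in> M \<Longrightarrow> \<not> sublist m (a # w @ [b])"
  shows "\<not> strong_groebner_basis R X r (monomials R (two_letter_terms R \<alpha> a \<beta> b M)) I"
    (is "\<not> strong_groebner_basis _ _ _ (monomials R ?T) _")
proof
  interpret domain R by fact
  interpret P: ring "free_algebra R X"
    using ring_axioms by (rule free_algebra_ring)
  assume basis: "strong_groebner_basis R X r (monomials R ?T) I"
  let ?p = "a # w @ [b]"
  have T: "?T \<subseteq> (carrier R - {\<zero>\<^bsub>R\<^esub>}) \<times> lists X"
    using coeffs words by (auto simp: two_letter_terms_def)
  have sub: "monomials R ?T \<subseteq> carrier (free_algebra R X)"
    using T by (auto simp: monomials_def intro!: nc_monom_in_carrier[OF ring_axioms])
  interpret I: ideal I "free_algebra R X"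
    using basis P.genideal_ideal[OF sub] by (simp add: strong_groebner_basis_def)
  have gen: "monomials R ?T \<subseteq> I"
    using basis P.genideal_self[OF sub] by (simp add: strong_groebner_basis_def)
  have "nc_monom R \<alpha> [a] \<otimes>\<^bsub>free_algebra R X\<^esub> nc_monom R \<sigma> (w @ [b]) \<in> I"
    using gen words comaximal
    by (intro I.I_r_closed nc_monom_in_carrier ring_axioms)
      (auto simp: monomials_def two_letter_terms_def)
  moreover have "nc_monom R \<tau> (a # w) \<otimes>\<^bsub>free_algebra R X\<^esub> nc_monom R \<beta> [b] \<in> I"
    using gen words comaximal
    by (intro I.I_l_closed nc_monom_in_carrier ring_axioms)
      (auto simp: monomials_def two_letter_terms_def)
  ultimately have "nc_monom R \<one>\<^bsub>R\<^esub> ?p \<in> I"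
    using I.a_closed comaximal coeffs
    by (fastforce simp: nc_monom_mult[OF ring_axioms] nc_monom_add[OF ring_axioms] m_comm)
  moreover have "nc_monom R \<one>\<^bsub>R\<^esub> ?p \<noteq> \<zero>\<^bsub>free_algebra R X\<^esub>"
    by (simp add: nc_monom_eq_zero_iff)
  ultimately obtain c u where cu: "(c, u) \<in> ?T"
      and div: "lt_divides R r (nc_monom R c u) (nc_monom R \<one>\<^bsub>R\<^esub> ?p)"
    using basis by (fastforce simp: strong_groebner_basis_def monomials_def)
  have "c \<noteq> \<zero>\<^bsub>R\<^esub>" "(u, u) \<in> r" "(?p, ?p) \<in> r"
    using cu T words by (auto intro!: monomial_well_order_refl[OF r])
  then have "c divides\<^bsub>R\<^esub> \<one>\<^bsub>R\<^esub>" "sublist u ?p"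
    using div by (simp_all add: lt_divides_def lc_nc_monom lm_nc_monom)
  then show False
    using cu nonunits avoid by (auto simp: two_letter_terms_def)
qed


section \<open>A copy of the integers\<close>

text \<open>
  The type of coefficients is an arbitrary infinite type, so the ring structure of the integers is
  transported to it along an injection.
\<close>

definition int_copy :: "(int \<Rightarrow> 'a) \<Rightarrow> 'a ring" where
  "int_copy h = \<lparr>carrier = range h,
     mult = (\<lambda>x y. h (inv_into UNIV h x * inv_into UNIV h y)), one = h 1,
     zero = h 0, add = (\<lambda>x y. h (inv_into UNIV h x + inv_into UNIV h y))\<rparr>"

lemma domain_int_copy:
  assumes "inj h"
  shows "domain (int_copy h)"
proof -
  have "abelian_group (int_copy h)"
  proof (rule abelian_groupI)
    fix x assume "x \<in> carrier (int_copy h)"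
    then show "\<exists>y\<in>carrier (int_copy h). y \<oplus>\<^bsub>int_copy h\<^esub> x = \<zero>\<^bsub>int_copy h\<^esub>"
      using assms by (intro bexI[of _ "h (- inv_into UNIV h x)"]) (auto simp: int_copy_def)
  qed (use assms in \<open>auto simp: int_copy_def algebra_simps\<close>)
  moreover have "comm_monoid (int_copy h)"
    by (rule comm_monoidI) (use assms in \<open>auto simp: int_copy_def algebra_simps\<close>)
  ultimately have "cring (int_copy h)"
    by (rule cringI) (use assms in \<open>auto simp: int_copy_def algebra_simps\<close>)
  then show ?thesis
    by (rule domain.intro) (unfold_locales, use assms in \<open>auto simp: int_copy_def inj_eq\<close>)
qed

lemma euclidean_norm_int_copy:
  assumes "inj h"
  shows "euclidean_norm (int_copy h) (\<lambda>x. nat \<bar>inv_into UNIV h x\<bar>)"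
proof -
  interpret domain "int_copy h"
    using assms by (rule domain_int_copy)
  have "euclidean_domain (int_copy h) (\<lambda>x. nat \<bar>inv_into UNIV h x\<bar>)"
  proof (rule euclidean_domainI)
    fix x y
    assume "x \<in> carrier (int_copy h) - {\<zero>\<^bsub>int_copy h\<^esub>}" "y \<in> carrier (int_copy h) - {\<zero>\<^bsub>int_copy h\<^esub>}"
    then obtain i j where "x = h i" "y = h j" "j \<noteq> 0"
      by (auto simp: int_copy_def)
    then show "\<exists>q s. q \<in> carrier (int_copy h) \<and> s \<in> carrier (int_copy h) \<and>
        x = y \<otimes>\<^bsub>int_copy h\<^esub> q \<oplus>\<^bsub>int_copy h\<^esub> s \<and>
        (s = \<zero>\<^bsub>int_copy h\<^esub> \<or> nat \<bar>inv_into UNIV h s\<bar> < nat \<bar>inv_into UNIV h y\<bar>)"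
      using assms abs_mod_less[of j i]
      by (intro exI[of _ "h (i div j)"] exI[of _ "h (i mod j)"]) (auto simp: int_copy_def)
  qed
  have bound: "nat \<bar>i\<bar> \<le> nat \<bar>i * j\<bar>" if "j \<noteq> 0" for i j :: int
  proof -
    have "\<bar>i\<bar> * 1 \<le> \<bar>i\<bar> * \<bar>j\<bar>"
      using that by (intro mult_left_mono) auto
    then show ?thesis
      by (simp add: abs_mult)
  qed
  have "nat \<bar>inv_into UNIV h x\<bar> \<le> nat \<bar>inv_into UNIV h (x \<otimes>\<^bsub>int_copy h\<^esub> y)\<bar>"
    if "x \<in> carrier (int_copy h) - {\<zero>\<^bsub>int_copy h\<^esub>}" "y \<in> carrier (int_copy h) - {\<zero>\<^bsub>int_copy h\<^esub>}" for x y
  proof -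
    obtain i j where "x = h i" "y = h j" "j \<noteq> 0"
      using \<open>x \<in> _\<close> \<open>y \<in> _\<close> by (auto simp: int_copy_def)
    with bound[of j i] show ?thesis
      using assms by (simp add: int_copy_def)
  qed
  with \<open>euclidean_domain _ _\<close> show ?thesis
    by (simp add: euclidean_norm_def)
qed

lemma int_copy_divides_one_iff:
  assumes "inj h"
  shows "h i divides\<^bsub>int_copy h\<^esub> \<one>\<^bsub>int_copy h\<^esub> \<longleftrightarrow> i dvd 1"
proof -
  have "h i divides\<^bsub>int_copy h\<^esub> \<one>\<^bsub>int_copy h\<^esub> \<longleftrightarrow> (\<exists>j. h 1 = h (i * j))"
    using assms by (simp add: factor_def int_copy_def)
  then show ?thesis
    using assms by (simp add: dvd_def inj_eq)
qed


section \<open>The shortlex ordering\<close>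

lemma shortlex_exists:
  obtains r where "monomial_well_order X r" and "length_compatible r"
proof -
  obtain s :: "'a rel" where "well_order_on UNIV s"
    using well_order_on by blast
  then have lin: "linear_order_on UNIV s" and wf: "wf (s - Id)"
    by (auto simp: well_order_on_def)
  \<comment> \<open>Words are compared by length first and then letter by letter, with respect to an arbitrary
    well-ordering of the letters.\<close>
  define q where "q = lenlex (s - Id)"
  define r where "r = {(u, v). u \<in> lists X \<and> v \<in> lists X \<and> (u = v \<or> (u, v) \<in> q)}"
  have "trans (s - Id)"
    using lin by (auto simp: order_on_defs intro: trans_diff_Id)
  then have trans: "trans q"
    unfolding q_def by (rule lenlex_transI)
  have wfq: "wf q"
    unfolding q_def using wf by (rule wf_lenlex)
  have "total (s - Id)"
    using lin by (auto simp: order_on_defs)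
  then have total: "total q"
    unfolding q_def by (rule total_lenlex)
  have irrefl: "irrefl (s - Id)"
    by (auto simp: irrefl_def)
  have "linear_order_on (lists X) r"
    unfolding order_on_defs
  proof (intro conjI)
    show "refl_on (lists X) r"
      by (auto simp: refl_on_def r_def)
    show "trans r"
      using trans by (auto simp: trans_def r_def)
    show "antisym r"
      using wf_not_sym[OF wfq] by (auto simp: antisym_def r_def)
    show "total_on (lists X) r"
      using total by (auto simp: total_on_def r_def)
  qed (auto simp: r_def)
  moreover have "wf (r - Id)"
    using wfq by (rule wf_subset) (auto simp: r_def)
  moreover have "(x @ u @ y, x @ v @ y) \<in> q" if "(u, v) \<in> q" for u v x y
    using that irrefl by (simp add: q_def lenlex_append1)
  ultimately have "monomial_well_order X r"
    by (auto simp: monomial_well_order_def well_order_on_def r_def)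
  moreover have "length_compatible r"
    by (auto simp: length_compatible_def r_def q_def dest: lenlex_length)
  ultimately show thesis
    by (rule that)
qed


section \<open>Words confined to a path\<close>

definition off_path_pairs :: "(nat \<Rightarrow> 'x) \<Rightarrow> nat \<Rightarrow> 'x list set" where
  "off_path_pairs e n = {[e i, e j] | i j. i \<le> n \<and> j \<le> n \<and> j \<noteq> Suc i}"

text \<open>
  The starting index \<open>i\<close> is left open for the sake of the induction: a factor of the path may
  start anywhere.
\<close>

lemma word_avoiding_off_path_pairs:
  assumes "inj e" and "t \<in> lists (e ` {..n})"
    and "\<And>m. m \<in> off_path_pairs e n \<Longrightarrow> \<not> sublist m t"
  shows "\<exists>i. t = map e [i..<i + length t]"
  using assms(2,3)
proof (induction t rule: list.induct)
  case Nil
  show ?case by simp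
next
  case (Cons x t)
  obtain i where i: "x = e i" "i \<le> n"
    using Cons.prems(1) by auto
  have "\<not> sublist m t" if "m \<in> off_path_pairs e n" for m
    using Cons.prems(2)[OF that] by (metis sublist_Cons_right)
  then obtain j where j: "t = map e [j..<j + length t]"
    using Cons by auto
  show ?case
  proof (cases t)
    case Nil
    then show ?thesis
      using i by (intro exI[of _ i]) simp
  next
    case (Cons y t')
    then have y: "y = e j"
      using j by (simp add: upt_rec)
    obtain k where "y = e k" "k \<le> n"
      using Cons Cons.prems(1) by auto
    with y \<open>inj e\<close> have "j \<le> n"
      by (simp add: inj_eq)
    have "sublist [x, y] (x # t)"
      by (simp add: Cons sublist_Cons_right)
    then have "[e i, e j] \<notin> off_path_pairs e n"
      using Cons.prems(2) i y by blast
    then have "j = Suc i"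
      using i \<open>j \<le> n\<close> by (auto simp: off_path_pairs_def)
    have "map e [i..<i + length (x # t)] = e i # map e [Suc i..<Suc i + length t]"
      by (simp add: upt_conv_Cons del: upt_Suc)
    also have "\<dots> = x # t"
      using i(1) j[unfolded \<open>j = Suc i\<close>, symmetric] by (simp del: upt_Suc)
    finally have "x # t = map e [i..<i + length (x # t)]" ..
    then show ?thesis ..
  qed
qed

lemma path_avoids_off_path_pairs:
  assumes "inj e" and "m \<in> off_path_pairs e n"
  shows "\<not> sublist m (map e [0..<k])"
proof
  obtain i j where m: "m = [e i, e j]" "j \<noteq> Suc i"
    using assms(2) by (auto simp: off_path_pairs_def)
  assume "sublist m (map e [0..<k])"
  then obtain x y where xy: "map e [0..<k] = x @ [e i, e j] @ y"
    by (auto simp: sublist_def m)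
  have len: "Suc (length x) < k"
    using arg_cong[OF xy, of length] by simp
  have "map e [0..<k] ! length x = e i" "map e [0..<k] ! Suc (length x) = e j"
    unfolding xy by (simp_all add: nth_append)
  moreover have "map e [0..<k] ! l = e l" if "l < k" for l
    using that by simp
  ultimately have "e (length x) = e i" "e (Suc (length x)) = e j"
    using len by simp_all
  then show False
    using assms(1) m(2) by (simp add: inj_eq)
qed

lemma long_if_both_ends_and_no_off_path_pair:
  assumes "inj e" and "t \<in> lists (e ` {..n})" and "e 0 \<in> set t" and "e n \<in> set t"
    and "\<And>m. m \<in> off_path_pairs e n \<Longrightarrow> \<not> sublist m t"
  shows "n < length t"
proof -
  obtain i where i: "t = map e [i..<i + length t]"
    using word_avoiding_off_path_pairs[OF assms(1,2,5)] by blast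
  have "set t = e ` {i..<i + length t}"
    by (subst i) (simp only: set_map set_upt)
  with assms(1,3,4) have "0 \<in> {i..<i + length t}" "n \<in> {i..<i + length t}"
    by (metis inj_image_mem_iff)+
  then show ?thesis
    by simp
qed

theorem lemma16:
  fixes b :: "nat \<Rightarrow> nat"
    and bez cof :: "'a ring \<Rightarrow> ('a \<Rightarrow> nat) \<Rightarrow> 'a \<Rightarrow> 'a \<Rightarrow> 'a \<times> 'a"
  assumes "infinite (UNIV :: 'a set)" and "infinite (UNIV :: 'x set)"
    and "\<And>(R :: 'a ring) \<phi>. euclidean_norm R \<phi> \<Longrightarrow> gcd_lcm_choice R (bez R \<phi>) (cof R \<phi>)"
    and "\<And>(R :: 'a ring) \<phi> (X :: 'x set) r d G.
      \<lbrakk> euclidean_norm R \<phi>; finite X;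
        monomial_well_order X r; length_compatible r;
        finite G; G \<subseteq> carrier (free_algebra R X) - {\<zero>\<^bsub>free_algebra R X\<^esub>};
        \<forall>g\<in>G. \<forall>u\<in>supp R g. length u \<le> d;
        no_new_polynomials R \<phi> (bez R \<phi>) (cof R \<phi>) X r (b d) G \<rbrakk>
      \<Longrightarrow> strong_groebner_basis R X r G (Idl\<^bsub>free_algebra R X\<^esub> G)"
  shows "\<forall>d. int (b d) \<ge> 3 * int d - 1"
proof (intro allI)
  fix d
  obtain g :: "nat \<Rightarrow> 'a" where g: "inj g"
    using infinite_countable_subset[OF assms(1)] by blast
  obtain e :: "nat \<Rightarrow> 'x" where e: "inj e"
    using infinite_countable_subset[OF assms(2)] by blast
  define h :: "int \<Rightarrow> 'a" where "h = g \<circ> int_encode"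
  have h: "inj h"
    unfolding h_def using g by (intro inj_compose inj_int_encode)
  define R where "R = int_copy h"
  define \<phi> where "\<phi> = (\<lambda>x. nat \<bar>inv_into UNIV h x\<bar>)"
  have norm: "euclidean_norm R \<phi>"
    unfolding R_def \<phi>_def using h by (rule euclidean_norm_int_copy)
  have dom: "domain R"
    unfolding R_def using h by (rule domain_int_copy)
  then interpret domain R .
  have coeffs: "h 2 \<in> carrier R - {\<zero>\<^bsub>R\<^esub>}" "h 3 \<in> carrier R - {\<zero>\<^bsub>R\<^esub>}"
    using h by (auto simp: R_def int_copy_def inj_eq)
  have nonunits: "\<not> h 2 divides\<^bsub>R\<^esub> \<one>\<^bsub>R\<^esub>" "\<not> h 3 divides\<^bsub>R\<^esub> \<one>\<^bsub>R\<^esub>"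
    using int_copy_divides_one_iff[OF h] by (simp_all add: R_def)
  have comaximal: "\<one>\<^bsub>R\<^esub> = h (- 1) \<otimes>\<^bsub>R\<^esub> h 2 \<oplus>\<^bsub>R\<^esub> \<one>\<^bsub>R\<^esub> \<otimes>\<^bsub>R\<^esub> h 3" "h (- 1) \<in> carrier R" "\<one>\<^bsub>R\<^esub> \<in> carrier R"
    using h by (auto simp: R_def int_copy_def)

  \<comment> \<open>The two lengths \<open>d = 1\<close> and \<open>d \<ge> 2\<close> differ only in \<open>n\<close> and \<open>M\<close>.\<close>
  have escape: False
    if M: "M \<subseteq> off_path_pairs e n" "\<forall>m\<in>M. length m \<le> d" and n: "0 < n" and d: "1 \<le> d"
      and short: "\<And>t. \<lbrakk> t \<in> lists (e ` {..n}); length t \<le> b d; e 0 \<in> set t; e n \<in> set t \<rbrakk>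
        \<Longrightarrow> \<exists>m\<in>M. sublist m t"
    for n M
  proof -
    define X where "X = e ` {..n}"
    define T where "T = two_letter_terms R (h 2) (e 0) (h 3) (e n) M"
    obtain r where r: "monomial_well_order X r" "length_compatible r"
      by (rule shortlex_exists)
    have "off_path_pairs e n \<subseteq> lists X"
      by (auto simp: X_def off_path_pairs_def)
    with M(1) have words: "e 0 \<in> X" "e n \<in> X" "M \<subseteq> lists X"
      by (auto simp: X_def)
    have T: "T \<subseteq> (carrier R - {\<zero>\<^bsub>R\<^esub>}) \<times> (lists X \<inter> {u. length u \<le> d})"
      using coeffs words M d by (auto simp: T_def two_letter_terms_def)
    have "off_path_pairs e n \<subseteq> (\<lambda>(i, j). [e i, e j]) ` ({..n} \<times> {..n})"
      by (auto simp: off_path_pairs_def)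
    then have "finite M"
      using M(1) by (meson finite_SigmaI finite_atMost finite_imageI finite_subset)
    then have "finite (monomials R T)"
      by (simp add: monomials_def T_def two_letter_terms_def)
    moreover have "monomials R T \<subseteq> carrier (free_algebra R X) - {\<zero>\<^bsub>free_algebra R X\<^esub>}"
      using T by (auto simp: monomials_def nc_monom_eq_zero_iff
          intro!: nc_monom_in_carrier[OF ring_axioms])
    moreover have "\<forall>f\<in>monomials R T. \<forall>u\<in>supp R f. length u \<le> d"
    proof -
      have "supp R (nc_monom R c u) = {u} \<and> length u \<le> d" if "(c, u) \<in> T" for c u
      proof -
        have "c \<noteq> \<zero>\<^bsub>R\<^esub>" "length u \<le> d"
          using T that by auto
        then show ?thesis
          by (simp add: supp_nc_monom)
      qed
      then show ?thesis
        by (fastforce simp: monomials_def)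
    qed
    moreover have "no_new_polynomials R \<phi> (bez R \<phi>) (cof R \<phi>) X r (b d) (monomials R T)"
      unfolding T_def using dom r(1) assms(3)[OF norm] coeffs words short
      by (intro no_new_polynomials_two_letters) (auto simp: X_def)
    ultimately have "strong_groebner_basis R X r (monomials R T) (Idl\<^bsub>free_algebra R X\<^esub> (monomials R T))"
      using norm r by (intro assms(4)[where d = d]) (auto simp: X_def)
    moreover have "\<not> strong_groebner_basis R X r (monomials R T) (Idl\<^bsub>free_algebra R X\<^esub> (monomials R T))"
      unfolding T_def
    proof (rule not_strong_groebner_basis_two_letters[OF dom r(1) coeffs nonunits comaximal])
      show "map e [1..<n] \<in> lists X"
        by (auto simp: X_def)
      have "e 0 # map e [1..<n] @ [e n] = map e [0..<Suc n]"
        using n by (simp add: upt_conv_Cons)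
      then show "\<not> sublist m (e 0 # map e [1..<n] @ [e n])" if "m \<in> M" for m
        using path_avoids_off_path_pairs[OF e] M(1) that by (metis subsetD)
    qed (use words in auto)
    ultimately show False
      by blast
  qed

  consider "d = 0" | "d = 1" | "2 \<le> d"
    by linarith
  then show "int (b d) \<ge> 3 * int d - 1"
  proof cases
    case 1
    then show ?thesis by simp
  next
    case 2
    have "\<not> b 1 \<le> 1"
    proof
      assume "b 1 \<le> 1"
      have "\<not> length t \<le> b d" if "e 0 \<in> set t" "e 1 \<in> set t" for t
      proof -
        have "card {e 0, e 1} \<le> card (set t)"
          using that by (intro card_mono) auto
        then show ?thesis
          using e 2 \<open>b 1 \<le> 1\<close> card_length[of t] by (simp add: inj_eq)
      qed
      then show False
        using escape[of "{}" 1] 2 by auto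
    qed
    with 2 show ?thesis by simp
  next
    case 3
    have "\<exists>m\<in>off_path_pairs e (Suc (b d)). sublist m t"
      if "t \<in> lists (e ` {..Suc (b d)})" "length t \<le> b d" "e 0 \<in> set t" "e (Suc (b d)) \<in> set t" for t
      using long_if_both_ends_and_no_off_path_pair[OF e that(1,3,4)] that(2) by fastforce
    then have False
      using 3 by (intro escape[of "off_path_pairs e (Suc (b d))" "Suc (b d)"])
        (auto simp: off_path_pairs_def)
    then show ?thesis ..
  qed
qed

end
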